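(* Let $s\ge1$ and let $y\in\operatorname{supp}\mu$ with $\mu(\{y\})=0$. Assume that for every nonincreasing sequence of radii $(\rho_n)_{n\in\mathbb{N}}$ with $\sum_n\mu(B(y,\rho_n))^s=\infty$, the sequence of balls $\{B(y,\rho_n)\}$ is a BC sequence for $T$. Then for $\mu$-a.e. $x\in X$, $$\liminf_{n\to\infty}\,n^{\beta}\,d(T^nx,y)=0\qquad\text{for every real }\beta<\frac{1}{s\,\underline{d}_\mu(y)}.$$
   Context: Standing assumptions: $(X,d)$ is a metric space, $\mu$ is a Borel probability measure on $X$, and $T:X\to X$ is measurable and preserves $\mu$, i.e. $\mu(T^{-1}A)=\mu(A)$ for all Borel $A$. $\mathbb{N}=\{1,2,\dots\}$. $B(y,r)=\{x\in X: d(x,y)\le r\}$ is the closed ball of center $y$ and radius $r>0$. The support $\operatorname{supp}\mu$ is the set of $y$ with $\mu(B(y,r))>0$ for all $r>0$. BC sequence: a sequence $\{A_n\}_{n\in\mathbb{N}}$ of measurable subsets of $X$ is a Borel-Cantelli (BC) sequence for $T$ if $\mu(\limsup_n T^{-n}A_n)=1$, where $\limsup_n T^{-n}A_n=\{x: T^nx\in A_n\text{ for infinitely many }n\}$. Lower local dimension: $\underline{d}_\mu(y)=\liminf_{r\to0}\frac{\log\mu(B(y,r))}{\log r}\in[0,\infty]$. Conventions: $1/(s\cdot0)=\infty$ and $1/\infty=0$. *)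

theory Defs
  imports "HOL-Probability.Probability"
begin

definition measure_preserving_map :: "'a measure \<Rightarrow> ('a \<Rightarrow> 'a) \<Rightarrow> bool" where
  "measure_preserving_map M T \<longleftrightarrow>
     T \<in> M \<rightarrow>\<^sub>M M \<and> (\<forall>A\<in>sets M. measure M (T -` A \<inter> space M) = measure M A)"

(* Sequences are indexed by the positive integers; the value at 0 plays no role. *)
definition borel_cantelli_seq :: "'a measure \<Rightarrow> ('a \<Rightarrow> 'a) \<Rightarrow> (nat \<Rightarrow> 'a set) \<Rightarrow> bool" where
  "borel_cantelli_seq M T A \<longleftrightarrow>
     (\<forall>n\<ge>1. A n \<in> sets M) \<and>
     measure M {x \<in> space M. \<exists>\<^sub>F n in sequentially. (T ^^ n) x \<in> A n} = 1"

definition measure_support :: "'a::metric_space measure \<Rightarrow> 'a set" where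
  "measure_support M = {y. \<forall>r>0. measure M (cball y r) > 0}"

(* Only meaningful at points of the support: there every ball has positive measure, so the
   convention ln 0 = 0 does not interfere. *)
definition lower_local_dim :: "'a::metric_space measure \<Rightarrow> 'a \<Rightarrow> ereal" where
  "lower_local_dim M y =
     Liminf (at_right 0) (\<lambda>r::real. ereal (ln (measure M (cball y r)) / ln r))"

end

theory Submission
  imports Defs "HOL-Real_Asymp.Real_Asymp"
begin

text \<open>
  For \<open>q > 0\<close> with \<open>s \<cdot> d < 1/q\<close>, where \<open>d\<close> is the lower local dimension at \<open>y\<close>, the radii
  \<open>n powr -q\<close> satisfy the divergence hypothesis: although the lower local dimension only controls
  \<open>\<mu>(B(y,r)) \<ge> r powr d'\<close> along some \<open>r \<rightarrow> 0\<close>, monotonicity lets one such \<open>r\<close> bound all terms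
  with \<open>n \<le> r powr (-1/q)\<close> from below, and their sum is of order \<open>r powr (s \<cdot> d' - 1/q)\<close>. So almost
  every orbit satisfies \<open>d(T\<^sup>n x, y) \<le> n powr -q\<close> infinitely often, and countably many \<open>q\<close> suffice.
\<close>

text \<open>The partial sum f 1 + ... + f N is at least N * f N by monotonicity, so no finite value
  bounds the series. Index 0 is left out because, in the application, \<open>0 powr -q = 0\<close>
  can break monotonicity there.\<close>

lemma suminf_antimono_eq_top:
  fixes f :: "nat \<Rightarrow> real"
  assumes antimono: "antimono_on {1..} f"
    and nonneg: "\<And>n. 0 \<le> f n"
    and unbounded: "\<And>C. \<exists>N. C \<le> real N * f N"
  shows "(\<Sum>n. ennreal (f (Suc n))) = \<infinity>"
proof (rule ccontr)
  assume "(\<Sum>n. ennreal (f (Suc n))) \<noteq> \<infinity>"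
  then obtain c where c: "c \<ge> 0" "(\<Sum>n. ennreal (f (Suc n))) = ennreal c"
    by (cases "\<Sum>n. ennreal (f (Suc n))") auto
  obtain N where N: "c + 1 \<le> real N * f N"
    using unbounded by blast
  have "real N * f N = (\<Sum>n<N. f N)"
    by simp
  also have "\<dots> \<le> (\<Sum>n<N. f (Suc n))"
    by (intro sum_mono monotone_onD[OF antimono]) auto
  finally have "ennreal (c + 1) \<le> ennreal (\<Sum>n<N. f (Suc n))"
    using N by (intro ennreal_leI) linarith
  also have "\<dots> = (\<Sum>n<N. ennreal (f (Suc n)))"
    by (simp add: nonneg)
  also have "\<dots> \<le> ennreal c"
    unfolding c(2)[symmetric] by (intro sum_le_suminf) auto
  finally show False
    using c(1) by (simp add: ennreal_le_iff)
qed

lemma lower_local_dim_nonneg: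
  assumes "prob_space M" and "y \<in> measure_support M"
  shows "0 \<le> lower_local_dim M y"
  unfolding lower_local_dim_def
proof (rule Liminf_bounded)
  have "\<forall>\<^sub>F r::real in at_right 0. 0 < r \<and> r < 1"
    using eventually_at_right_real[of 0 "1::real"] by simp
  then show "\<forall>\<^sub>F r in at_right 0. 0 \<le> ereal (ln (measure M (cball y r)) / ln r)"
  proof eventually_elim
    case (elim r)
    have "0 < measure M (cball y r)" "measure M (cball y r) \<le> 1"
      using assms elim by (auto simp: measure_support_def prob_space.prob_le_1)
    then show ?case
      using elim by (simp add: divide_nonpos_neg)
  qed
qed

text \<open>The case \<open>q = 0\<close>, with constant radius 1, serves the exponents
  \<open>\<beta> < 0\<close>; it is the only admissible \<open>q\<close> when the lower local
  dimension is infinite.\<close>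

lemma suminf_measure_cball_powr_eq_top:
  fixes M :: "'a::metric_space measure"
  assumes "prob_space M" and sets: "sets M = sets borel"
    and "s > 0" and supp: "y \<in> measure_support M"
    and q: "q = 0 \<or> q > 0 \<and> ereal s * lower_local_dim M y < ereal (1 / q)"
  shows "(\<Sum>n. ennreal (measure M (cball y (real (Suc n) powr - q)) powr s)) = \<infinity>"
proof -
  interpret prob_space M by fact
  have pos: "0 < measure M (cball y r)" if "r > 0" for r
    using supp that by (simp add: measure_support_def)
  have mono: "measure M (cball y r) powr s \<le> measure M (cball y r') powr s" if "r \<le> r'" for r r'
    using that \<open>s > 0\<close>
    by (intro powr_mono2 finite_measure_mono) (auto simp: sets)
  define f where "f n = measure M (cball y (real n powr - q)) powr s" for n :: nat
  have "(\<Sum>n. ennreal (f (Suc n))) = \<infinity>"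
  proof (rule suminf_antimono_eq_top)
    show "antimono_on {1..} f"
      unfolding f_def using q by (intro monotone_onI mono powr_mono2') auto
    show "0 \<le> f n" for n
      by (simp add: f_def)
    show "\<exists>N. C \<le> real N * f N" for C
    proof (cases "q = 0")
      case True
      define c where "c = measure M (cball y 1) powr s"
      have "c > 0"
        using pos[of 1] by (simp add: c_def)
      obtain N :: nat where "C / c < real N"
        using reals_Archimedean2 by blast
      \<comment> \<open>The witness has to be positive: \<open>0 powr 0 = 0\<close>, so the radius
        is 1 only from index 1 on.\<close>
      then have "C \<le> real (Suc N) * c"
        using \<open>c > 0\<close> by (simp add: field_simps)
      then show ?thesis
        using True by (intro exI[of _ "Suc N"]) (simp add: f_def c_def)
    next
      case False
      then have "q > 0" and less: "ereal s * lower_local_dim M y < ereal (1 / q)"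
        using q by auto
      have "lower_local_dim M y < ereal (1 / (q * s))"
        using less \<open>q > 0\<close> \<open>s > 0\<close> by (cases "lower_local_dim M y") (auto simp: field_simps)
      \<comment> \<open>The left gap gives arbitrarily small \<open>r\<close> whose ball has measure
        at least \<open>r powr d\<close>; the right gap gives \<open>e < p\<close> below.\<close>
      then obtain d where d: "lower_local_dim M y < ereal d" "d < 1 / (q * s)"
        using ereal_dense2 by (metis less_ereal.simps(1))
      have "0 < d"
        using lower_local_dim_nonneg[OF \<open>prob_space M\<close> supp] d(1)
        by (metis ereal_less(2) order_le_less_trans)
      define p e where "p = 1 / q" and "e = s * d"
      have ep: "0 < e" "e < p"
        using d(2) \<open>0 < d\<close> \<open>q > 0\<close> \<open>s > 0\<close> by (auto simp: e_def p_def field_simps)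
      have freq: "\<exists>\<^sub>F r in at_right 0. ln (measure M (cball y r)) / ln r < d"
      proof (rule ccontr)
        assume "\<not> ?thesis"
        then have "ereal d \<le> lower_local_dim M y"
          unfolding lower_local_dim_def not_frequently
          by (intro Liminf_bounded) (simp add: not_less)
        with d(1) show False
          by simp
      qed
      \<comment> \<open>This product will bound \<open>N * f N\<close> from below, its first factor
        bounding \<open>N\<close> and its second \<open>f N\<close>. It blows up because
        \<open>e < p\<close>.\<close>
      have "filterlim (\<lambda>r::real. (r powr - p - 1) * r powr e) at_top (at_right 0)"
        using ep by real_asymp
      then have "\<forall>\<^sub>F r::real in at_right 0. C \<le> (r powr - p - 1) * r powr e"
        by (simp add: filterlim_at_top)
      moreover have "\<forall>\<^sub>F r::real in at_right 0. 0 < r \<and> r < 1"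
        using eventually_at_right_real[of 0 "1::real"] by simp
      ultimately have "\<forall>\<^sub>F r::real in at_right 0.
          C \<le> (r powr - p - 1) * r powr e \<and> 0 < r \<and> r < 1"
        by eventually_elim auto
      from frequently_ex[OF frequently_eventually_conj[OF freq this]]
      obtain r where r: "ln (measure M (cball y r)) / ln r < d"
        "C \<le> (r powr - p - 1) * r powr e" "0 < r" "r < 1"
        by auto
      \<comment> \<open>Multiplying by \<open>ln r < 0\<close> reverses the inequality.\<close>
      have "d * ln r < ln (measure M (cball y r))"
        using r by (simp add: divide_less_eq)
      then have "r powr d \<le> measure M (cball y r)"
        using pos[of r] r(3) by (simp add: powr_def ln_ge_iff[symmetric])
      then have "(r powr d) powr s \<le> measure M (cball y r) powr s"
        using \<open>s > 0\<close> by (intro powr_mono2) auto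
      then have e_le: "r powr e \<le> measure M (cball y r) powr s"
        by (simp add: powr_powr e_def mult.commute)
      \<comment> \<open>The largest index whose radius \<open>N powr -q\<close> is still at least
        \<open>r\<close>, so that the \<open>N\<close>-th ball contains the ball of radius
        \<open>r\<close>.\<close>
      define N where "N = nat \<lfloor>r powr - p\<rfloor>"
      have "1 powr - p \<le> r powr - p"
        using r ep by (intro powr_mono2') auto
      then have N: "1 \<le> N" "real N \<le> r powr - p" "r powr - p - 1 \<le> real N"
        unfolding N_def by (auto simp: le_nat_iff)
      have "r = (r powr - p) powr - q"
        using r \<open>q > 0\<close> by (simp add: powr_powr p_def)
      also have "\<dots> \<le> real N powr - q"
        using N \<open>q > 0\<close> by (intro powr_mono2') auto
      finally have "r powr e \<le> f N"
        unfolding f_def using mono e_le order_trans by blast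
      then have "(r powr - p - 1) * r powr e \<le> real N * f N"
        using N by (intro mult_mono) auto
      with r(2) show ?thesis
        by (meson order_trans)
    qed
  qed
  then show ?thesis
    by (simp add: f_def)
qed

text \<open>At the infinitely many good \<open>n\<close> the term is at most
  \<open>n powr (\<beta> - q)\<close>, which tends to 0; a positive liminf would keep the terms
  eventually above some \<open>c > 0\<close>.\<close>

lemma liminf_powr_times_eq_0:
  fixes g :: "nat \<Rightarrow> real"
  assumes "\<And>n. 0 \<le> g n" and freq: "\<exists>\<^sub>F n in sequentially. g n \<le> real n powr - q" and "\<beta> < q"
  shows "liminf (\<lambda>n. ereal (real n powr \<beta> * g n)) = 0"
proof (rule antisym)
  show "0 \<le> liminf (\<lambda>n. ereal (real n powr \<beta> * g n))"
    using assms(1) by (intro Liminf_bounded) (simp add: zero_ereal_def)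
  show "liminf (\<lambda>n. ereal (real n powr \<beta> * g n)) \<le> 0"
  proof (rule ccontr)
    assume "\<not> ?thesis"
    then have "0 < liminf (\<lambda>n. ereal (real n powr \<beta> * g n))"
      by (simp only: not_le)
    from ereal_dense2[OF this]
    obtain c where c: "0 < ereal c" "ereal c < liminf (\<lambda>n. ereal (real n powr \<beta> * g n))"
      by auto
    have "(\<lambda>n. real n powr (\<beta> - q)) \<longlonglongrightarrow> 0"
      using \<open>\<beta> < q\<close> by real_asymp
    then have "\<forall>\<^sub>F n in sequentially. real n powr (\<beta> - q) < c"
      using c(1) by (intro order_tendstoD) auto
    moreover have "\<forall>\<^sub>F n in sequentially. c < real n powr \<beta> * g n"
      using less_LiminfD[OF c(2)] by simp
    ultimately have "\<forall>\<^sub>F n in sequentially. \<not> g n \<le> real n powr - q"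
    proof eventually_elim
      case (elim n)
      show ?case
      proof
        assume "g n \<le> real n powr - q"
        then have "real n powr \<beta> * g n \<le> real n powr \<beta> * real n powr - q"
          by (intro mult_left_mono) auto
        also have "\<dots> = real n powr (\<beta> - q)"
          by (simp flip: powr_add)
        finally show False
          using elim by simp
      qed
    qed
    with freq show False
      by (simp add: frequently_def)
  qed
qed

theorem theorem5p1:
  fixes M :: "'a::metric_space measure" and T :: "'a \<Rightarrow> 'a" and y :: 'a and s :: real
  assumes "prob_space M" and "sets M = sets borel"
    and "measure_preserving_map M T"
    and "s \<ge> 1"
    and "y \<in> measure_support M" and "measure M {y} = 0"
    and "\<And>\<rho> :: nat \<Rightarrow> real.
           (\<forall>n\<ge>1. \<rho> n > 0) \<Longrightarrow> antimono_on {1..} \<rho> \<Longrightarrow>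
           (\<Sum>n. ennreal (measure M (cball y (\<rho> (Suc n))) powr s)) = \<infinity> \<Longrightarrow>
           borel_cantelli_seq M T (\<lambda>n. cball y (\<rho> n))"
  shows "AE x in M. \<forall>\<beta>::real. ereal \<beta> < 1 / (ereal s * lower_local_dim M y) \<longrightarrow>
           liminf (\<lambda>n. ereal (real n powr \<beta> * dist ((T ^^ n) x) y)) = 0"
proof -
  interpret prob_space M by fact
  let ?d = "lower_local_dim M y"
  \<comment> \<open>Rational exponents keep the union of the exceptional null sets null, so one set
    of full measure serves all real \<open>\<beta>\<close> at once.\<close>
  define Q where "Q = {q \<in> \<rat>. q = 0 \<or> q > 0 \<and> ereal s * ?d < ereal (1 / q)}"
  have "countable Q"
    unfolding Q_def by (rule countable_subset[OF _ countable_rat]) auto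
  have "AE x in M. \<exists>\<^sub>F n in sequentially. dist ((T ^^ n) x) y \<le> real n powr - q"
    if "q \<in> Q" for q
  proof -
    have q: "q = 0 \<or> q > 0 \<and> ereal s * ?d < ereal (1 / q)"
      using that by (simp add: Q_def)
    have "borel_cantelli_seq M T (\<lambda>n. cball y (real n powr - q))"
    proof (rule assms(7))
      show "antimono_on {1..} (\<lambda>n. real n powr - q)"
        using q by (intro monotone_onI powr_mono2') auto
      show "(\<Sum>n. ennreal (measure M (cball y (real (Suc n) powr - q)) powr s)) = \<infinity>"
        using assms q by (intro suminf_measure_cball_powr_eq_top) auto
    qed auto
    then have "AE x in M. x \<in> {x \<in> space M.
        \<exists>\<^sub>F n in sequentially. (T ^^ n) x \<in> cball y (real n powr - q)}"
      unfolding borel_cantelli_seq_def by (intro AE_prob_1) auto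
    then show ?thesis
      by eventually_elim (simp add: dist_commute)
  qed
  then have recurs: "AE x in M. \<forall>q\<in>Q. \<exists>\<^sub>F n in sequentially. dist ((T ^^ n) x) y \<le> real n powr - q"
    by (simp add: AE_ball_countable[OF \<open>countable Q\<close>])
  have exponent: "\<exists>q\<in>Q. \<beta> < q" if \<beta>: "ereal \<beta> < 1 / (ereal s * ?d)" for \<beta>
  proof (cases "\<beta> < 0")
    case True
    then show ?thesis
      by (intro bexI[of _ 0]) (auto simp: Q_def)
  next
    case False
    \<comment> \<open>The bound may be infinite, so a real \<open>u\<close> is inserted before the
      density of the rationals is used.\<close>
    obtain u where u: "\<beta> < u" "ereal u < 1 / (ereal s * ?d)"
      using ereal_dense2[OF \<beta>] by auto
    obtain q where q: "q \<in> \<rat>" "\<beta> < q" "q < u"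
      using Rats_dense_in_real[OF u(1)] by blast
    have "q > 0" "ereal q < 1 / (ereal s * ?d)"
      using False q u(2) by (auto intro: less_trans[of _ "ereal u"])
    \<comment> \<open>Inverting is safe as the dimension is nonnegative. If it is 0, the left side
      is 0; if it is infinite, the bound on \<open>q\<close> is 0, contradicting
      \<open>q > 0\<close>.\<close>
    then have "ereal s * ?d < ereal (1 / q)"
      using \<open>s \<ge> 1\<close> lower_local_dim_nonneg[OF assms(1,5)]
      by (cases ?d; cases "?d = 0")
        (auto simp: field_simps zero_ereal_def one_ereal_def)
    with q \<open>q > 0\<close> show ?thesis
      by (auto simp: Q_def)
  qed
  show ?thesis
    using recurs
  proof eventually_elim
    case (elim x)
    then show ?case
      using exponent liminf_powr_times_eq_0[of "\<lambda>n. dist ((T ^^ n) x) y"]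
      by (meson zero_le_dist)
  qed
qed

end
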